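(* Consider the Two-Stage Robust Matching Bottleneck problem (TSRMB) with the budget of uncertainty set $\mathcal{S}=\{S\subseteq R_2:|S|\le k\}$ with $k=1$ (and arbitrary surplus). Let $OPT_1$ and $OPT_2$ be the first-stage and second-stage costs of an optimal solution. Let $S\subseteq R_2$ be an inclusion-maximal (greedily constructed) set of second-stage riders that are pairwise at distance greater than $2\,OPT_2$, and let $D_1$ be an optimal solution of the single-scenario problem $$\min_{D_1\subseteq D,\ |D_1|=|R_1|}\{cost_1(D_1,R_1)+cost_2(D\setminus D_1,S)\}.$$ Then $D_1$ is a solution of TSRMB with total cost $f(D_1)\le OPT_1+3\,OPT_2$.
   Context: TSRMB: an instance consists of finite sets $D$ (drivers), $R_1$ (first-stage riders, $m=|R_1|$), $R_2$ (potential second-stage riders), a nonempty family $\mathcal{S}$ of subsets of $R_2$ (scenarios), and a metric $d$ on $V=R_1\cup R_2\cup D$. It is assumed that there are enough drivers: $|D|\ge |R_1|+\max_{S\in\mathcal{S}}|S|$. A feasible solution is a set $D_1\subseteq D$ with $|D_1|=|R_1|$. Define $cost_1(D_1,R_1)=\frac1m\sum_{(i,j)\in M_1}d(i,j)$, where $M_1$ is a minimum-weight perfect matching between $R_1$ and $D_1$. For a set of drivers $A$ and a set of riders $S$, $cost_2(A,S)$ is the bottleneck matching cost: the minimum, over all matchings of $A$ and $S$ covering every element of $S$, of the largest distance $d(i,j)$ of a matched pair ($0$ if $S=\emptyset$, $+\infty$ if no such matching exists). The objective is to minimize $f(D_1)=cost_1(D_1,R_1)+\max_{S\in\mathcal{S}}cost_2(D\setminus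 D_1,S)$. For an optimal solution $D_1^*$, $OPT_1=cost_1(D_1^*,R_1)$, $OPT_2=\max_{S\in\mathcal{S}}cost_2(D\setminus D_1^*,S)$, $OPT=OPT_1+OPT_2$. *)

theory Defs
  imports
    "HOL-Analysis.Abstract_Metric_Spaces"
    "HOL-Library.Extended_Nonnegative_Real"
begin

definition matching :: "'a set \<Rightarrow> 'a set \<Rightarrow> ('a \<times> 'a) set \<Rightarrow> bool" where
  "matching A B M \<longleftrightarrow> M \<subseteq> A \<times> B \<and> inj_on fst M \<and> inj_on snd M"

definition perfect_matching :: "'a set \<Rightarrow> 'a set \<Rightarrow> ('a \<times> 'a) set \<Rightarrow> bool" where
  "perfect_matching A B M \<longleftrightarrow> matching A B M \<and> fst ` M = A \<and> snd ` M = B"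

definition weight :: "('a \<Rightarrow> 'a \<Rightarrow> real) \<Rightarrow> ('a \<times> 'a) set \<Rightarrow> real" where
  "weight d M = (\<Sum>(i, j)\<in>M. d i j)"

(* Only meaningful for finite D1, R1 of equal size, when a minimum-weight perfect matching exists. *)
definition cost1 :: "('a \<Rightarrow> 'a \<Rightarrow> real) \<Rightarrow> 'a set \<Rightarrow> 'a set \<Rightarrow> real" where
  "cost1 d D1 R1 =
     (1 / real (card R1)) * weight d (arg_min (weight d) (perfect_matching R1 D1))"

(* In ennreal the infimum over the empty set is infinite (no matching covers S), and the
   supremum over the empty matching is 0 (S is empty).  For finite A and S, the infimum and
   supremum are otherwise a minimum and a maximum. *)
definition cost2 :: "('a \<Rightarrow> 'a \<Rightarrow> real) \<Rightarrow> 'a set \<Rightarrow> 'a set \<Rightarrow> ennreal" where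
  "cost2 d A S = (INF M \<in> {M. matching A S M \<and> snd ` M = S}. SUP (i, j) \<in> M. ennreal (d i j))"

locale tsrmb = Metric_space "R1 \<union> R2 \<union> D" d
  for D R1 R2 :: "'a set" and Sc :: "'a set set" and d :: "'a \<Rightarrow> 'a \<Rightarrow> real" +
  assumes finite_D: "finite D"
    and finite_R1: "finite R1"
    and finite_R2: "finite R2"
    and scenarios_nonempty: "Sc \<noteq> {}"
    and scenarios_subset: "\<And>S. S \<in> Sc \<Longrightarrow> S \<subseteq> R2"
    and enough_drivers: "card R1 + Max (card ` Sc) \<le> card D"

definition feasible :: "'a set \<Rightarrow> 'a set \<Rightarrow> 'a set \<Rightarrow> bool" where
  "feasible D R1 D1 \<longleftrightarrow> D1 \<subseteq> D \<and> card D1 = card R1"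

(* The supremum is a maximum, as the scenario family of an instance is finite and nonempty. *)
definition worst_cost2 ::
  "('a \<Rightarrow> 'a \<Rightarrow> real) \<Rightarrow> 'a set \<Rightarrow> 'a set set \<Rightarrow> 'a set \<Rightarrow> ennreal" where
  "worst_cost2 d D Sc D1 = (SUP S \<in> Sc. cost2 d (D - D1) S)"

definition total_cost ::
  "('a \<Rightarrow> 'a \<Rightarrow> real) \<Rightarrow> 'a set \<Rightarrow> 'a set \<Rightarrow> 'a set set \<Rightarrow> 'a set \<Rightarrow> ennreal" where
  "total_cost d D R1 Sc D1 = ennreal (cost1 d D1 R1) + worst_cost2 d D Sc D1"

definition budget_scenarios :: "'a set \<Rightarrow> nat \<Rightarrow> 'a set set" where
  "budget_scenarios R2 k = {S. S \<subseteq> R2 \<and> card S \<le> k}"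

definition separated :: "('a \<Rightarrow> 'a \<Rightarrow> real) \<Rightarrow> ennreal \<Rightarrow> 'a set \<Rightarrow> bool" where
  "separated d \<delta> S \<longleftrightarrow> pairwise (\<lambda>i j. \<delta> < ennreal (d i j)) S"

definition maximal_separated ::
  "('a \<Rightarrow> 'a \<Rightarrow> real) \<Rightarrow> ennreal \<Rightarrow> 'a set \<Rightarrow> 'a set \<Rightarrow> bool" where
  "maximal_separated d \<delta> R S \<longleftrightarrow>
     S \<subseteq> R \<and> separated d \<delta> S \<and> (\<forall>T. S \<subset> T \<and> T \<subseteq> R \<longrightarrow> \<not> separated d \<delta> T)"

end

theory Submission
  imports Defs
begin

text \<open>
  An optimal solution leaves, for every second-stage rider, an unused driver within distance
  \<open>OPT\<^sub>2\<close>. Riders of \<open>S\<close> are more than \<open>2 OPT\<^sub>2\<close> apart, so by the triangle inequality these drivers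
  are distinct and match \<open>S\<close> at bottleneck cost at most \<open>OPT\<^sub>2\<close>. Hence the single-scenario
  optimum for \<open>S\<close> is at most \<open>OPT\<^sub>1 + OPT\<^sub>2\<close>. By maximality of \<open>S\<close> every rider is within
  \<open>2 OPT\<^sub>2\<close> of \<open>S\<close>, and can be served by the driver matched to a nearby rider of \<open>S\<close>.
\<close>

lemma cost2_leI:
  assumes "matching A S M" "snd ` M = S"
    and "\<And>i j. (i, j) \<in> M \<Longrightarrow> ennreal (d i j) \<le> c"
  shows "cost2 d A S \<le> c"
  unfolding cost2_def
proof (rule INF_lower2)
  show "M \<in> {M. matching A S M \<and> snd ` M = S}"
    using assms by simp
  show "(SUP (i, j)\<in>M. ennreal (d i j)) \<le> c"
    using assms(3) by (auto intro!: SUP_least)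
qed

lemma cost2_empty [simp]: "cost2 d A {} = 0"
proof -
  have "cost2 d A {} \<le> 0"
    by (rule cost2_leI [of _ _ "{}"]) (auto simp: matching_def)
  then show ?thesis by simp
qed

lemma cost2_singleton_le:
  assumes "i \<in> A"
  shows "cost2 d A {j} \<le> ennreal (d i j)"
  using assms by (intro cost2_leI [of _ _ "{(i, j)}"]) (auto simp: matching_def)

text \<open>Only finitely many matchings live inside \<open>A \<times> S\<close>, and a finite cost
  rules out the empty infimum \<open>top\<close>; hence the infimum is a minimum.\<close>

lemma cost2_attained:
  assumes "finite A" "finite S" "cost2 d A S < top"
  obtains M where "matching A S M" "snd ` M = S"
    and "\<And>i j. (i, j) \<in> M \<Longrightarrow> ennreal (d i j) \<le> cost2 d A S"
proof -
  let ?Ms = "{M. matching A S M \<and> snd ` M = S}"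
  let ?bottleneck = "\<lambda>M. SUP (i, j) \<in> M. ennreal (d i j)"
  have "?Ms \<subseteq> Pow (A \<times> S)"
    by (auto simp: matching_def)
  then have "finite ?Ms"
    by (rule finite_subset) (simp add: assms)
  moreover have "?Ms \<noteq> {}"
    using assms(3) by (auto simp: cost2_def simp del: Collect_empty_eq)
  ultimately have "cost2 d A S \<in> ?bottleneck ` ?Ms"
    unfolding cost2_def by (subst cInf_eq_Min) (auto intro!: Min_in simp del: Collect_empty_eq)
  then obtain M where M: "M \<in> ?Ms" "cost2 d A S = ?bottleneck M"
    by blast
  have "ennreal (d i j) \<le> cost2 d A S" if "(i, j) \<in> M" for i j
    unfolding M(2) using that by (rule SUP_upper2) simp
  with M(1) show ?thesis
    by (intro that) auto
qed

lemma cost2_driver: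
  assumes "finite A" "finite S" "cost2 d A S < top" "s \<in> S"
  obtains i where "i \<in> A" "ennreal (d i s) \<le> cost2 d A S"
proof -
  obtain M where M: "matching A S M" "snd ` M = S"
    and le: "\<And>i j. (i, j) \<in> M \<Longrightarrow> ennreal (d i j) \<le> cost2 d A S"
    using cost2_attained [OF assms(1-3)] by blast
  from M(2) assms(4) obtain i where "(i, s) \<in> M"
    by force
  with M(1) le show ?thesis
    by (intro that [of i]) (auto simp: matching_def)
qed

text \<open>Otherwise \<open>insert r S\<close> would still be separated, against maximality.
  Symmetry is assumed because \<open>pairwise_insert\<close> asks for both orders of each new
  pair.\<close>

lemma maximal_separated_near:
  assumes "maximal_separated d \<delta> R S" "r \<in> R" "r \<notin> S"
    and "\<And>x y. d x y = d y x"
  obtains s where "s \<in> S" "ennreal (d s r) \<le> \<delta>"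
proof -
  have "\<not> separated d \<delta> (insert r S)" "separated d \<delta> S"
    using assms(1-3) by (auto simp: maximal_separated_def)
  then have "\<exists>s\<in>S. \<not> \<delta> < ennreal (d s r)"
    unfolding separated_def pairwise_insert using assms(4) by metis
  then show ?thesis
    using that by (auto simp: not_less)
qed

context Metric_space
begin

lemma ennreal_triangle:
  assumes "x \<in> M" "y \<in> M" "z \<in> M"
  shows "ennreal (d x z) \<le> ennreal (d x y) + ennreal (d y z)"
  using triangle [OF assms] by (simp add: ennreal_leI flip: ennreal_plus)

text \<open>A driver within \<open>c\<close> of two riders would put them within
  \<open>2 * c\<close> of each other, so nearby drivers chosen independently never collide and form
  a matching.\<close>

lemma cost2_separated_le:
  assumes "separated d (2 * c) S" "A \<subseteq> M" "S \<subseteq> M"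
    and near: "\<And>s. s \<in> S \<Longrightarrow> \<exists>i\<in>A. ennreal (d i s) \<le> c"
  shows "cost2 d A S \<le> c"
proof -
  obtain g where g: "\<And>s. s \<in> S \<Longrightarrow> g s \<in> A \<and> ennreal (d (g s) s) \<le> c"
    using near by metis
  have "inj_on g S"
  proof (rule inj_onI, rule ccontr)
    fix s t assume st: "s \<in> S" "t \<in> S" "g s = g t" "s \<noteq> t"
    have "ennreal (d s t) \<le> ennreal (d s (g s)) + ennreal (d (g s) t)"
      using st g assms(2,3) by (intro ennreal_triangle) auto
    also have "\<dots> \<le> c + c"
      using g [OF st(1)] g [OF st(2)] st(3) by (intro add_mono) (auto simp: commute)
    also have "\<dots> = 2 * c"
      by (simp add: mult_2)
    also have "\<dots> < ennreal (d s t)"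
      using assms(1) st by (auto simp: separated_def pairwise_def)
    finally show False
      by simp
  qed
  then show ?thesis
    using g by (intro cost2_leI [of _ _ "(\<lambda>s. (g s, s)) ` S"])
      (auto simp: matching_def inj_on_def image_image)
qed

text \<open>The driver matched to some \<open>s\<close> in \<open>S\<close> near \<open>r\<close>
  serves \<open>r\<close> instead, and the detour from \<open>s\<close> to \<open>r\<close> adds at
  most \<open>\<delta>\<close>.\<close>

lemma cost2_singleton_le_maximal_separated:
  assumes "maximal_separated d \<delta> R S" "A \<subseteq> M" "R \<subseteq> M" "finite A" "finite R" "r \<in> R"
  shows "cost2 d A {r} \<le> cost2 d A S + \<delta>"
proof (cases "cost2 d A S < top")
  case True
  have SR: "S \<subseteq> R"
    using assms(1) by (simp add: maximal_separated_def)
  obtain s where s: "s \<in> S" "ennreal (d s r) \<le> \<delta>"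
  \<comment> \<open>Maximality only speaks of riders outside \<open>S\<close>; a rider in
    \<open>S\<close> is its own neighbour, at distance 0.\<close>
  proof (cases "r \<in> S")
    case True
    moreover have "d r r = 0"
      using assms(3,6) by auto
    ultimately show ?thesis
      by (intro that [of r]) auto
  next
    case False
    then show ?thesis
      using maximal_separated_near [OF assms(1,6)] commute that by metis
  qed
  obtain i where i: "i \<in> A" "ennreal (d i s) \<le> cost2 d A S"
    using cost2_driver [OF assms(4) finite_subset [OF SR assms(5)] True s(1)] by blast
  have "cost2 d A {r} \<le> ennreal (d i r)"
    using i(1) by (rule cost2_singleton_le)
  also have "\<dots> \<le> ennreal (d i s) + ennreal (d s r)"
    using i s SR assms by (intro ennreal_triangle) auto
  also have "\<dots> \<le> cost2 d A S + \<delta>"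
    using i s by (intro add_mono)
  finally show ?thesis .
qed (simp add: not_less top_unique)

end

text \<open>Finiteness matters: an infinite subset has \<open>card\<close> 0 and would count as a
  scenario.\<close>

lemma budget_scenarios_1:
  assumes "finite R2"
  shows "budget_scenarios R2 1 = insert {} ((\<lambda>r. {r}) ` R2)"
proof -
  have "S = {} \<or> (\<exists>r. S = {r})" if "S \<subseteq> R2" "card S \<le> 1" for S
    using that assms finite_subset [of S R2]
    by (auto simp: le_Suc_eq card_Suc_eq)
  then show ?thesis
    by (auto simp: budget_scenarios_def)
qed

text \<open>The empty scenario costs 0, the bottom of \<open>ennreal\<close>, so it drops out of the
  supremum even if \<open>R2\<close> is empty.\<close>

lemma worst_cost2_budget_1:
  assumes "finite R2"
  shows "worst_cost2 d D (budget_scenarios R2 1) D1 = (SUP r\<in>R2. cost2 d (D - D1) {r})"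
  unfolding worst_cost2_def budget_scenarios_1 [OF assms]
  by (simp add: image_image flip: bot_ennreal)

theorem theorem8:
  fixes D R1 R2 D_opt S D1 :: "'a set"
    and d :: "'a \<Rightarrow> 'a \<Rightarrow> real"
    and OPT1 :: real and OPT2 :: ennreal
  assumes instance_TSRMB: "tsrmb D R1 R2 (budget_scenarios R2 1) d"
    and opt: "is_arg_min (total_cost d D R1 (budget_scenarios R2 1)) (feasible D R1) D_opt"
    and OPT1: "OPT1 = cost1 d D_opt R1"
    and OPT2: "OPT2 = worst_cost2 d D (budget_scenarios R2 1) D_opt"
    and S: "maximal_separated d (2 * OPT2) R2 S"
    and D1: "is_arg_min (\<lambda>D1. ennreal (cost1 d D1 R1) + cost2 d (D - D1) S) (feasible D R1) D1"
  shows "feasible D R1 D1 \<and>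
    total_cost d D R1 (budget_scenarios R2 1) D1 \<le> ennreal OPT1 + 3 * OPT2"
proof -
  interpret tsrmb D R1 R2 "budget_scenarios R2 1" d
    by (rule instance_TSRMB)
  note worst = worst_cost2_budget_1 [OF finite_R2]
  have feas: "feasible D R1 D1" "feasible D R1 D_opt"
    using D1 opt by (auto simp: is_arg_min_def)
  have "total_cost d D R1 (budget_scenarios R2 1) D1 \<le> ennreal OPT1 + 3 * OPT2"
  \<comment> \<open>An infinite \<open>OPT2\<close> makes the bound \<open>top\<close>; a finite one
    lets \<open>cost2_driver\<close> extract actual drivers.\<close>
  proof (cases "OPT2 < top")
    case True
    have near: "\<exists>i\<in>D - D_opt. ennreal (d i s) \<le> OPT2" if "s \<in> R2" for s
    proof -
      have le: "cost2 d (D - D_opt) {s} \<le> OPT2"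
        unfolding OPT2 worst using that by (rule SUP_upper)
      obtain i where "i \<in> D - D_opt" "ennreal (d i s) \<le> cost2 d (D - D_opt) {s}"
        using cost2_driver [of "D - D_opt" "{s}" d s] finite_D le_less_trans [OF le True] by auto
      with le show ?thesis
        by (meson order_trans)
    qed
    have "cost2 d (D - D_opt) S \<le> OPT2"
      using S near by (intro cost2_separated_le) (auto simp: maximal_separated_def)
    \<comment> \<open>\<open>D_opt\<close> competes in the single-scenario problem that
      \<open>D1\<close> solves.\<close>
    moreover have "ennreal (cost1 d D1 R1) + cost2 d (D - D1) S
        \<le> ennreal (cost1 d D_opt R1) + cost2 d (D - D_opt) S"
      using D1 feas(2) by (auto simp: is_arg_min_linorder)
    ultimately have "ennreal (cost1 d D1 R1) + cost2 d (D - D1) S \<le> ennreal OPT1 + OPT2"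
      unfolding OPT1 by (meson add_left_mono order_trans)
    moreover have "worst_cost2 d D (budget_scenarios R2 1) D1 \<le> cost2 d (D - D1) S + 2 * OPT2"
      unfolding worst using S finite_D finite_R2
      by (intro SUP_least cost2_singleton_le_maximal_separated) auto
    ultimately have "ennreal (cost1 d D1 R1) + worst_cost2 d D (budget_scenarios R2 1) D1
        \<le> ennreal (cost1 d D1 R1) + (cost2 d (D - D1) S + 2 * OPT2)"
      and "ennreal (cost1 d D1 R1) + cost2 d (D - D1) S + 2 * OPT2 \<le> ennreal OPT1 + OPT2 + 2 * OPT2"
      by (auto intro: add_left_mono add_right_mono)
    then have "total_cost d D R1 (budget_scenarios R2 1) D1 \<le> ennreal OPT1 + OPT2 + 2 * OPT2"
      unfolding total_cost_def add.assoc by (rule order_trans)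
    \<comment> \<open>The factor 3 is one \<open>OPT2\<close> for serving \<open>S\<close> and two
      for the detour.\<close>
    also have "\<dots> = ennreal OPT1 + (1 + 2) * OPT2"
      by (simp only: distrib_right add.assoc mult_1_left)
    finally show ?thesis
      by simp
  qed (simp add: not_less top_unique ennreal_mult_top)
  with feas(1) show ?thesis
    by simp
qed

end
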